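(* Let $S$ be a $(v,k,\mu)$ sum set in a finite group $G$ of order $v$, let $n = k^2 - \mu v$, and suppose $G$ has a normal subgroup $N$ of index $3$. If the three numbers $|S \cap C|$, as $C$ ranges over the three cosets of $N$ in $G$, are pairwise distinct, then $3$ divides $k$, $|S \cap N| = k/3$, and $n = -3x^2$ for some nonzero integer $x$.
   Context: For $a \in G$, the number of ways to write $a$ as a product in $S$ is the number of ordered pairs $(x,y) \in S\times S$ with $xy = a$. $S$ with $|S|=k$ is a $(v,k,\mu)$ sum set if every nonidentity element of $G$ can be written as a product in $S$ in exactly $\mu$ ways. *)

theory Defs
  imports "HOL-Algebra.Coset"
begin

definition num_ways :: "('a, 'b) monoid_scheme \<Rightarrow> 'a set \<Rightarrow> 'a \<Rightarrow> nat" where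
  "num_ways G S a = card {(x, y). x \<in> S \<and> y \<in> S \<and> x \<otimes>\<^bsub>G\<^esub> y = a}"

definition sum_set :: "('a, 'b) monoid_scheme \<Rightarrow> nat \<Rightarrow> nat \<Rightarrow> nat \<Rightarrow> 'a set \<Rightarrow> bool" where
  "sum_set G v k \<mu> S \<longleftrightarrow>
     order G = v \<and> S \<subseteq> carrier G \<and> card S = k \<and>
     (\<forall>a \<in> carrier G - {\<one>\<^bsub>G\<^esub>}. num_ways G S a = \<mu>)"

end

theory Submission imports Defs begin

text \<open>
  Write \<open>a\<close>, \<open>b\<close>, \<open>c\<close> for the sizes of the intersections of \<open>S\<close> with \<open>N\<close> and the two other
  cosets \<open>C\<close>, \<open>D\<close>. As \<open>G/N\<close> is cyclic of order 3, counting the pairs in \<open>S \<times> S\<close> with product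
  in \<open>C\<close>, respectively \<open>D\<close>, gives \<open>2ab + c\<^sup>2 = \<mu>v/3 = 2ac + b\<^sup>2\<close>, that is,
  \<open>(b - c)(b + c - 2a) = 0\<close>. Hence \<open>b + c = 2a\<close>, so \<open>k = 3a\<close> and
  \<open>n = 9a\<^sup>2 - 3(2ab + c\<^sup>2) = -3(a - b)\<^sup>2\<close>.
\<close>

text \<open>Sorting the pairs by the value of their product splits the set on the right into
  disjoint fibres. For a sum set and \<open>A\<close> avoiding the identity, the left side is \<mu>
  times \<open>card A\<close>.\<close>

lemma sum_num_ways:
  assumes "finite S" "finite A"
  shows "(\<Sum>a\<in>A. num_ways G S a) = card {(x, y). x \<in> S \<and> y \<in> S \<and> x \<otimes>\<^bsub>G\<^esub> y \<in> A}"
proof -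
  let ?P = "\<lambda>a. {(x, y). x \<in> S \<and> y \<in> S \<and> x \<otimes>\<^bsub>G\<^esub> y = a}"
  have fin: "finite (?P a)" for a
    by (rule finite_subset[of _ "S \<times> S"]) (use assms in auto)
  have "{(x, y). x \<in> S \<and> y \<in> S \<and> x \<otimes>\<^bsub>G\<^esub> y \<in> A} = (\<Union>a\<in>A. ?P a)"
    by auto
  also have "card \<dots> = (\<Sum>a\<in>A. card (?P a))"
    by (rule card_UN_disjoint) (use assms fin in auto)
  finally show ?thesis
    by (simp add: num_ways_def)
qed

text \<open>Each pair lies in exactly one block \<open>X \<times> Y\<close> of cosets. By normality
  all products from a block fall into the single coset \<open>X <#> Y\<close>, so a block counts
  entirely or not at all.\<close>

lemma (in normal) card_pairs_mult_in_rcoset: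
  assumes "finite (carrier G)" "S \<subseteq> carrier G" "C \<in> rcosets H"
  shows "card {(x, y). x \<in> S \<and> y \<in> S \<and> x \<otimes> y \<in> C} =
    (\<Sum>X\<in>rcosets H. \<Sum>Y\<in>rcosets H. if X <#> Y = C then card (S \<inter> X) * card (S \<inter> Y) else 0)"
proof -
  let ?R = "rcosets H"
  let ?I = "{p \<in> ?R \<times> ?R. fst p <#> snd p = C}"
  let ?B = "\<lambda>p. (S \<inter> fst p) \<times> (S \<inter> snd p)"
  have finR: "finite ?R"
    using assms(1) by (simp add: RCOSETS_def)
  have finS: "finite S"
    using assms finite_subset by blast
  have disj: "X = Y" if "X \<in> ?R" "Y \<in> ?R" "x \<in> X" "x \<in> Y" for X Y x
    using rcos_disjoint[OF is_subgroup] that by (auto simp: pairwise_def disjnt_iff)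
  have "{(x, y). x \<in> S \<and> y \<in> S \<and> x \<otimes> y \<in> C} = (\<Union>p\<in>?I. ?B p)"
  proof (intro equalityI subsetI)
    fix p assume "p \<in> {(x, y). x \<in> S \<and> y \<in> S \<and> x \<otimes> y \<in> C}"
    then obtain x y where p: "p = (x, y)" "x \<in> S" "y \<in> S" "x \<otimes> y \<in> C" by auto
    have xy: "x \<in> carrier G" "y \<in> carrier G" using p assms by auto
    have "H #> x <#> (H #> y) = H #> (x \<otimes> y)" using xy by (rule rcos_sum)
    \<comment> \<open>Both cosets contain \<open>x \<otimes> y\<close>, hence coincide.\<close>
    moreover have "H #> (x \<otimes> y) = C"
      using disj[OF _ assms(3) _ p(4)] xy rcos_self[OF _ is_subgroup] rcosetsI[OF subset] by simp
    ultimately show "p \<in> (\<Union>p\<in>?I. ?B p)"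
      using p xy rcos_self[OF _ is_subgroup] rcosetsI[OF subset]
      by (intro UN_I[of "(H #> x, H #> y)"]) auto
  qed (auto simp: set_mult_def)
  also have "card \<dots> = (\<Sum>p\<in>?I. card (?B p))"
    using finR finS by (intro card_UN_disjoint) (auto dest: disj)
  also have "\<dots> = (\<Sum>p\<in>?R \<times> ?R. if fst p <#> snd p = C then card (?B p) else 0)"
    using finR by (intro sum.inter_filter) auto
  also have "\<dots> = (\<Sum>X\<in>?R. \<Sum>Y\<in>?R. if X <#> Y = C then card (S \<inter> X) * card (S \<inter> Y) else 0)"
    by (simp add: sum.cartesian_product case_prod_beta card_cartesian_product cong: if_cong)
  finally show ?thesis .
qed

text \<open>Cancellation rules out all other values: for instance \<open>c \<otimes> c = c\<close>
  would give \<open>c = \<one>\<close>, and \<open>c \<otimes> c = \<one> = c \<otimes> d\<close>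
  would give \<open>c = d\<close>. This is applied to \<open>G Mod N\<close>.\<close>

lemma (in group) mult_table_card_3:
  assumes "carrier G = {\<one>, c, d}" "c \<noteq> \<one>" "d \<noteq> \<one>" "c \<noteq> d"
  shows "c \<otimes> d = \<one>" "d \<otimes> c = \<one>" "c \<otimes> c = d" "d \<otimes> d = c"
proof -
  have cd: "c \<in> carrier G" "d \<in> carrier G" using assms by auto
  have tri: "x \<otimes> y = \<one> \<or> x \<otimes> y = c \<or> x \<otimes> y = d" if "x \<in> carrier G" "y \<in> carrier G" for x y
    using m_closed[OF that] assms(1) by auto
  show 1: "c \<otimes> d = \<one>" and 2: "d \<otimes> c = \<one>"
    using tri[of c d] tri[of d c] cd assms by auto
  show "c \<otimes> c = d"
    using tri[of c c] cd assms(2,4) 1 Units_l_cancel[of c c d] l_cancel_one[of c c] Units_eq by metis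
  show "d \<otimes> d = c"
    using tri[of d d] cd assms(3,4) 2 Units_l_cancel[of d d c] l_cancel_one[of d d] Units_eq by metis
qed

theorem theorem3p6:
  fixes G :: "('a, 'b) monoid_scheme" (structure)
    and S N :: "'a set" and v k \<mu> :: nat and n :: int
  assumes "group G"
    and "finite (carrier G)"
    and "sum_set G v k \<mu> S"
    and "n = int k ^ 2 - int \<mu> * int v"
    and "N \<lhd> G"
    and "card (rcosets N) = 3"
    and "\<And>C D. C \<in> rcosets N \<Longrightarrow> D \<in> rcosets N \<Longrightarrow> C \<noteq> D \<Longrightarrow>
           card (S \<inter> C) \<noteq> card (S \<inter> D)"
  shows "3 dvd k \<and> card (S \<inter> N) = k div 3 \<and> (\<exists>x::int. x \<noteq> 0 \<and> n = - 3 * x ^ 2)"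
proof -
  interpret normal N G by fact
  interpret Q: group "G Mod N" by (rule factorgroup_is_group)
  have NR: "N \<in> rcosets N"
    by (rule subgroup_in_rcosets) (rule assms)
  then have "card (rcosets N - {N}) = 2"
    using assms(6) by simp
  then obtain C D where "rcosets N - {N} = {C, D}" and "C \<noteq> D"
    unfolding card_2_iff by blast
  with NR have R: "rcosets N = {N, C, D}" and ne: "C \<noteq> N" "D \<noteq> N" "C \<noteq> D"
    by blast+
  have "carrier (G Mod N) = {\<one>\<^bsub>G Mod N\<^esub>, C, D}"
    by (simp add: FactGroup_def R)
  from Q.mult_table_card_3[OF this] ne
  have CD: "C <#> D = N" "D <#> C = N" "C <#> C = D" "D <#> D = C"
    by (simp_all add: FactGroup_def)
  have NX: "N <#> N = N" "N <#> C = C" "C <#> N = C" "N <#> D = D" "D <#> N = D"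
    using Q.l_one[of N] Q.l_one[of C] Q.r_one[of C] Q.l_one[of D] Q.r_one[of D]
    by (simp_all add: FactGroup_def R)
  have S: "S \<subseteq> carrier G" "card S = k" "order G = v"
    "\<And>a. a \<in> carrier G \<Longrightarrow> a \<noteq> \<one> \<Longrightarrow> num_ways G S a = \<mu>"
    using assms(3) by (auto simp: sum_set_def)
  have finS: "finite S" using S(1) assms(2) finite_subset by blast
  have disj: "X \<inter> Y = {}" if "X \<in> rcosets N" "Y \<in> rcosets N" "X \<noteq> Y" for X Y
    using rcos_disjoint[OF is_subgroup] that by (auto simp: pairwise_def disjnt_def)
  have v: "v = 3 * card N"
    using lagrange[OF is_subgroup] assms(6) S(3) by simp
  \<comment> \<open>The coset \<open>N\<close> is excluded because it contains the identity, where
    \<open>sum_set\<close> does not prescribe \<open>num_ways\<close>.\<close>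
  have count: "card {(x, y). x \<in> S \<and> y \<in> S \<and> x \<otimes> y \<in> X} = \<mu> * card N"
    if X: "X \<in> rcosets N" "X \<noteq> N" for X
  proof -
    have XG: "X \<subseteq> carrier G" using subgroup.rcosets_carrier[OF is_subgroup is_group X(1)] .
    moreover have "\<one> \<notin> X" using disj[OF X(1) NR X(2)] by auto
    ultimately have "(\<Sum>a\<in>X. num_ways G S a) = (\<Sum>a\<in>X. \<mu>)"
      by (intro sum.cong refl S(4)) auto
    moreover have "card X = card N"
      using card_rcosets_equal[OF X(1) subset] by simp
    ultimately show ?thesis
      using sum_num_ways[OF finS finite_subset[OF XG assms(2)], of G] by simp
  qed
  \<comment> \<open>Integers, because the argument subtracts these sizes and natural subtraction
    truncates.\<close>
  define a b c where "a = int (card (S \<inter> N))" and "b = int (card (S \<inter> C))"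
    and "c = int (card (S \<inter> D))"
  note pairs = card_pairs_mult_in_rcoset[OF assms(2) S(1)]
  have "\<mu> * card N = card {(x, y). x \<in> S \<and> y \<in> S \<and> x \<otimes> y \<in> C}"
    using count[of C] R ne by simp
  \<comment> \<open>Of the nine pairs of cosets, only \<open>(N, C)\<close>, \<open>(C, N)\<close>
    and \<open>(D, D)\<close> have product \<open>C\<close>.\<close>
  also have "\<dots> = 2 * card (S \<inter> N) * card (S \<inter> C) + card (S \<inter> D) * card (S \<inter> D)"
    using pairs[of C] by (simp add: R ne ne[symmetric] CD NX)
  finally have eC: "int (\<mu> * card N) = 2 * a * b + c * c"
    by (simp add: a_def b_def c_def)
  have "\<mu> * card N = card {(x, y). x \<in> S \<and> y \<in> S \<and> x \<otimes> y \<in> D}"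
    using count[of D] R ne by simp
  also have "\<dots> = 2 * card (S \<inter> N) * card (S \<inter> D) + card (S \<inter> C) * card (S \<inter> C)"
    using pairs[of D] by (simp add: R ne ne[symmetric] CD NX)
  finally have eD: "int (\<mu> * card N) = 2 * a * c + b * b"
    by (simp add: a_def b_def c_def)
  have "S = (S \<inter> N) \<union> ((S \<inter> C) \<union> (S \<inter> D))"
    using rcosets_part_G[OF is_subgroup] S(1) R by auto
  then have "k = card ((S \<inter> N) \<union> ((S \<inter> C) \<union> (S \<inter> D)))"
    using S(2) by simp
  also have "\<dots> = card (S \<inter> N) + (card (S \<inter> C) + card (S \<inter> D))"
  proof -
    have "(S \<inter> N) \<inter> ((S \<inter> C) \<union> (S \<inter> D)) = {}" "(S \<inter> C) \<inter> (S \<inter> D) = {}"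
      using disj[of N C] disj[of N D] disj[of C D] ne R by auto
    then show ?thesis
      using finS by (simp add: card_Un_disjoint)
  qed
  finally have kabc: "int k = a + b + c"
    by (simp add: a_def b_def c_def)
  have ab: "a \<noteq> b" and bc: "b \<noteq> c"
    using assms(7)[of N C] assms(7)[of C D] ne R by (auto simp: a_def b_def c_def)
  \<comment> \<open>This is the difference of \<open>eD\<close> and \<open>eC\<close>,
    factored.\<close>
  have "(b - c) * (b + c - 2 * a) = 0"
    using eC eD by (simp add: algebra_simps)
  then have c: "c = 2 * a - b"
    using bc by simp
  then have k: "k = 3 * card (S \<inter> N)"
    using kabc by (simp add: a_def)
  have "n = (3 * a)\<^sup>2 - 3 * int (\<mu> * card N)"
    using kabc c by (simp add: assms(4) v)
  \<comment> \<open>With \<open>c = 2 * a - b\<close>, the expression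
    \<open>9a^2 - 6ab - 3(2a - b)^2\<close> collapses to a multiple of a square, which supplies the
    witness \<open>a - b\<close>.\<close>
  also have "\<dots> = - 3 * (a - b)\<^sup>2"
    unfolding eC c by (simp add: power2_eq_square algebra_simps)
  finally have "n = - 3 * (a - b)\<^sup>2" .
  moreover have "a - b \<noteq> 0" using ab by simp
  ultimately have "\<exists>x::int. x \<noteq> 0 \<and> n = - 3 * x ^ 2" by blast
  with k show ?thesis by simp
qed

end
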